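(* Let $\mathfrak g_2$ be the complex Lie algebra with basis $\{e_1,e_2,e_3\}$ and only non-zero bracket (up to skew-symmetry) $[e_1,e_2]=e_3$, and let $\{e_1^*,e_2^*,e_3^*\}$ be the dual basis of $\mathfrak g_2^*$. Then the Lie algebra $\mathfrak g_2\ltimes_{\mathrm{ad}^*}\mathfrak g_2^*$ has basis $\{e_1,e_2,e_3,e_1^*,e_2^*,e_3^*\}$ with non-zero brackets (up to skew-symmetry) $$[e_1,e_2]=e_3,\quad [e_1,e_3^*]=-e_2^*,\quad [e_2,e_3^*]=e_1^*.$$ Moreover, for all complex parameters $n_{ij},\lambda$ subject to the stated restrictions, each of the following is a solution of the classical Yang–Baxter equation on this Lie algebra: - $r_1=(n_{21}e_1+n_{23}e_3)\otimes e_2^*-e_2^*\otimes(n_{21}e_1+n_{23}e_3)$; - $r_2=u\otimes e_1^*+v\otimes e_2^*-e_1^*\otimes u-e_2^*\otimes v$, where $u=n_{11}e_1+n_{12}e_2-\frac{n_{12}n_{23}}{n_{11}}e_3$ and $v=-\frac{n_{11}^2}{n_{12}}e_1-n_{11}e_2+n_{23}e_3$, $n_{11},n_{12}\neq0$; - $r_3=(n_{12}e_2+n_{13}e_3)\otimes e_1^*-e_1^*\otimes(n_{12}e_2+n_{13}e_3)$, $n_{12}\neq0$; - $r_4=n_{13}e_3\otimes e_1^*+n_{23}e_3\otimes e_2^*-e_1^*\otimes n_{13}e_3-e_2^*\otimes n_{23}e_3$; - $r_5=w\otimes e_1^*-k\,w\otimes e_2^*-e_1^*\otimes w+e_2^*\otimes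 k\,w$, where $k=\frac{-1+\sqrt{1-4\lambda}}{2}$ and $w=k n_{12}e_1+n_{12}e_2+n_{13}e_3$, $n_{12},\lambda\neq0$; - $r_6=w\otimes e_1^*-k\,w\otimes e_2^*-e_1^*\otimes w+e_2^*\otimes k\,w$, where $k=\frac{-1-\sqrt{1-4\lambda}}{2}$ and $w=k n_{12}e_1+n_{12}e_2+n_{13}e_3$, $n_{12},\lambda\neq0$.
   Context: For a Lie algebra $\mathfrak g$, the coadjoint representation $\mathrm{ad}^*:\mathfrak g\to\mathfrak{gl}(\mathfrak g^* )$ is $\langle\mathrm{ad}^*_x\xi,y\rangle=-\langle\xi,[x,y]\rangle$, and $\mathfrak g\ltimes_{\mathrm{ad}^*}\mathfrak g^*$ is $\mathfrak g\oplus\mathfrak g^*$ with bracket $[x_1+\xi_1,x_2+\xi_2]=[x_1,x_2]+\mathrm{ad}^*_{x_1}\xi_2-\mathrm{ad}^*_{x_2}\xi_1$. An element $r=\sum_i a_i\otimes b_i\in\mathfrak h\otimes\mathfrak h$ of a Lie algebra $\mathfrak h$ is a solution of the classical Yang–Baxter equation (CYBE) in $\mathfrak h$ if $[r_{12},r_{13}]+[r_{12},r_{23}]+[r_{13},r_{23}]=0$ in $U(\mathfrak h)^{\otimes 3}$, where $r_{12}=\sum_i a_i\otimes b_i\otimes1$, $r_{13}=\sum_i a_i\otimes1\otimes b_i$, $r_{23}=\sum_i1\otimes a_i\otimes b_i$ and $U(\mathfrak h)$ is the universal enveloping algebra. $\sqrt{1-4\lambda}$ denotes a fixed square root in $\mathbb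 C$. *)

theory Defs
  imports Complex_Main "HOL-Library.Poly_Mapping"
begin

section \<open>Complex vector spaces and algebras\<close>

class complex_vector = ab_group_add +
  fixes scaleC :: "complex \<Rightarrow> 'a \<Rightarrow> 'a"  (infixr \<open>*\<^sub>C\<close> 75)
  assumes scaleC_add_right: "c *\<^sub>C (x + y) = c *\<^sub>C x + c *\<^sub>C y"
    and scaleC_add_left: "(c + d) *\<^sub>C x = c *\<^sub>C x + d *\<^sub>C x"
    and scaleC_scaleC: "c *\<^sub>C (d *\<^sub>C x) = (c * d) *\<^sub>C x"
    and scaleC_one: "1 *\<^sub>C x = x"

global_interpretation complex_vector: vector_space "scaleC :: complex \<Rightarrow> 'a \<Rightarrow> 'a::complex_vector"
  by unfold_locales (simp_all add: scaleC_add_right scaleC_add_left scaleC_scaleC scaleC_one)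

instantiation complex :: complex_vector
begin
definition scaleC_complex :: "complex \<Rightarrow> complex \<Rightarrow> complex" where
  "scaleC_complex c z = c * z"
instance by standard (simp_all add: scaleC_complex_def algebra_simps)
end

instantiation poly_mapping :: (type, complex_vector) complex_vector
begin
lift_definition scaleC_poly_mapping :: "complex \<Rightarrow> ('a \<Rightarrow>\<^sub>0 'b) \<Rightarrow> ('a \<Rightarrow>\<^sub>0 'b)"
  is "\<lambda>c f k. c *\<^sub>C f k"
proof -
  fix c :: complex and f :: "'a \<Rightarrow> 'b" assume "finite {k. f k \<noteq> 0}"
  then show "finite {k. c *\<^sub>C f k \<noteq> 0}" by (rule rev_finite_subset) auto
qed
instance
  by standard (transfer; simp add: fun_eq_iff scaleC_add_right scaleC_add_left scaleC_scaleC scaleC_one)+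
end

abbreviation clinear :: "('a::complex_vector \<Rightarrow> 'b::complex_vector) \<Rightarrow> bool" where
  "clinear \<equiv> Vector_Spaces.linear scaleC scaleC"

lemma clinearI:
  assumes "\<And>x y. f (x + y) = f x + f y" "\<And>c x. f (c *\<^sub>C x) = c *\<^sub>C f x"
  shows "clinear f"
  using assms by unfold_locales auto

lemma clinear_add: "clinear f \<Longrightarrow> f (x + y) = f x + f y"
  by (rule module_hom.add[OF Vector_Spaces.linear.axioms(3)])

lemma clinear_scaleC: "clinear f \<Longrightarrow> f (c *\<^sub>C x) = c *\<^sub>C f x"
  by (rule module_hom.scale[OF Vector_Spaces.linear.axioms(3)])

lemma clinear_diff: "clinear f \<Longrightarrow> f (x - y) = f x - f y"
  by (rule module_hom.diff[OF Vector_Spaces.linear.axioms(3)])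

lemma clinear_0: "clinear f \<Longrightarrow> f 0 = 0"
  by (rule module_hom.zero[OF Vector_Spaces.linear.axioms(3)])

definition cbilinear ::
    "('a::complex_vector \<Rightarrow> 'b::complex_vector \<Rightarrow> 'c::complex_vector) \<Rightarrow> bool" where
  "cbilinear f \<longleftrightarrow> (\<forall>y. clinear (\<lambda>x. f x y)) \<and> (\<forall>x. clinear (f x))"

text \<open>Associative unital algebras; the zero algebra is allowed, as the class does not include
  \<open>0 \<noteq> 1\<close>.\<close>

class complex_algebra = complex_vector + ring + monoid_mult +
  assumes mult_scaleC_left: "(c *\<^sub>C x) * y = c *\<^sub>C (x * y)"
    and mult_scaleC_right: "x * (c *\<^sub>C y) = c *\<^sub>C (x * y)"

definition commutator :: "'a::ring \<Rightarrow> 'a \<Rightarrow> 'a" where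
  "commutator a b = a * b - b * a"


section \<open>Tensor products\<close>

text \<open>\<open>'k \<Rightarrow>\<^sub>0 complex\<close> is the complex vector space with basis \<open>single k 1\<close>, \<open>k :: 'k\<close>;
  \<open>lin_ext f\<close> is the linear extension of a map \<open>f\<close> defined on this basis.\<close>

definition lin_ext :: "('k \<Rightarrow> 'c::complex_vector) \<Rightarrow> ('k \<Rightarrow>\<^sub>0 complex) \<Rightarrow> 'c" where
  "lin_ext f p = (\<Sum>k\<in>Poly_Mapping.keys p. Poly_Mapping.lookup p k *\<^sub>C f k)"

lemma lin_ext_superset:
  assumes "finite A" "Poly_Mapping.keys p \<subseteq> A"
  shows "lin_ext f p = (\<Sum>k\<in>A. Poly_Mapping.lookup p k *\<^sub>C f k)"
  unfolding lin_ext_def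
  by (rule sum.mono_neutral_left) (use assms in \<open>auto simp: in_keys_iff\<close>)

lemma lookup_scaleC: "Poly_Mapping.lookup (c *\<^sub>C p) k = c *\<^sub>C Poly_Mapping.lookup p k"
  by transfer simp

lemma lin_ext_clinear:
  fixes f :: "'k \<Rightarrow> 'c::complex_vector"
  shows "clinear (lin_ext f)"
proof (rule clinearI)
  fix p q :: "'k \<Rightarrow>\<^sub>0 complex" and c :: complex
  let ?A = "Poly_Mapping.keys p \<union> Poly_Mapping.keys q"
  have "lin_ext f (p + q) = (\<Sum>k\<in>?A. Poly_Mapping.lookup (p + q) k *\<^sub>C f k)"
    by (rule lin_ext_superset) (auto simp: in_keys_iff lookup_add)
  moreover have "lin_ext f p = (\<Sum>k\<in>?A. Poly_Mapping.lookup p k *\<^sub>C f k)"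
    by (rule lin_ext_superset) auto
  moreover have "lin_ext f q = (\<Sum>k\<in>?A. Poly_Mapping.lookup q k *\<^sub>C f k)"
    by (rule lin_ext_superset) auto
  ultimately show "lin_ext f (p + q) = lin_ext f p + lin_ext f q"
    by (simp add: lookup_add scaleC_add_left sum.distrib)
  have "lin_ext f (c *\<^sub>C p) =
      (\<Sum>k\<in>Poly_Mapping.keys p. Poly_Mapping.lookup (c *\<^sub>C p) k *\<^sub>C f k)"
    by (rule lin_ext_superset) (auto simp: in_keys_iff lookup_scaleC scaleC_complex_def)
  then show "lin_ext f (c *\<^sub>C p) = c *\<^sub>C lin_ext f p"
    by (simp add: lin_ext_def lookup_scaleC scaleC_complex_def scaleC_scaleC
        complex_vector.scale_sum_right)
qed

lemma lin_ext_single: "lin_ext f (Poly_Mapping.single k c) = c *\<^sub>C f k"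
  by (subst lin_ext_superset[of "{k}"]) auto

inductive_set tensor_relations ::
    "(('a::complex_vector \<times> 'b::complex_vector) \<Rightarrow>\<^sub>0 complex) set" where
  "Poly_Mapping.single (a + a', b) 1 - Poly_Mapping.single (a, b) 1
     - Poly_Mapping.single (a', b) 1 \<in> tensor_relations"
| "Poly_Mapping.single (a, b + b') 1 - Poly_Mapping.single (a, b) 1
     - Poly_Mapping.single (a, b') 1 \<in> tensor_relations"
| "Poly_Mapping.single (c *\<^sub>C a, b) 1 - c *\<^sub>C Poly_Mapping.single (a, b) 1 \<in> tensor_relations"
| "Poly_Mapping.single (a, c *\<^sub>C b) 1 - c *\<^sub>C Poly_Mapping.single (a, b) 1 \<in> tensor_relations"

definition tensor_eq ::
    "(('a::complex_vector \<times> 'b::complex_vector) \<Rightarrow>\<^sub>0 complex) \<Rightarrow> ('a \<times> 'b \<Rightarrow>\<^sub>0 complex) \<Rightarrow> bool" where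
  "tensor_eq p q \<longleftrightarrow> p - q \<in> complex_vector.span tensor_relations"

lemma tensor_eq_equivp:
  "equivp (tensor_eq :: ('a::complex_vector \<times> 'b::complex_vector \<Rightarrow>\<^sub>0 complex) \<Rightarrow> _)"
proof (rule equivpI)
  show "reflp (tensor_eq :: ('a \<times> 'b \<Rightarrow>\<^sub>0 complex) \<Rightarrow> _)"
    by (auto simp: reflp_def tensor_eq_def complex_vector.span_zero)
  show "symp (tensor_eq :: ('a \<times> 'b \<Rightarrow>\<^sub>0 complex) \<Rightarrow> _)"
  proof (rule sympI)
    fix p q :: "'a \<times> 'b \<Rightarrow>\<^sub>0 complex" assume "tensor_eq p q"
    then show "tensor_eq q p"
      unfolding tensor_eq_def using complex_vector.span_neg by fastforce
  qed
  show "transp (tensor_eq :: ('a \<times> 'b \<Rightarrow>\<^sub>0 complex) \<Rightarrow> _)"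
  proof (rule transpI)
    fix p q r :: "'a \<times> 'b \<Rightarrow>\<^sub>0 complex" assume "tensor_eq p q" "tensor_eq q r"
    then have "(p - q) + (q - r) \<in> complex_vector.span tensor_relations"
      unfolding tensor_eq_def by (rule complex_vector.span_add)
    then show "tensor_eq p r" by (simp add: tensor_eq_def)
  qed
qed

quotient_type (overloaded) ('a, 'b) tensor =
  "('a::complex_vector \<times> 'b::complex_vector) \<Rightarrow>\<^sub>0 complex" / tensor_eq
  by (rule tensor_eq_equivp)

instantiation tensor :: (complex_vector, complex_vector) complex_vector
begin

lift_definition zero_tensor :: "('a, 'b) tensor" is 0 .

lift_definition plus_tensor :: "('a, 'b) tensor \<Rightarrow> ('a, 'b) tensor \<Rightarrow> ('a, 'b) tensor" is "(+)"
  unfolding tensor_eq_def by (metis add_diff_add complex_vector.span_add)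

lift_definition uminus_tensor :: "('a, 'b) tensor \<Rightarrow> ('a, 'b) tensor" is uminus
  unfolding tensor_eq_def using complex_vector.span_neg by (metis minus_diff_minus)

lift_definition minus_tensor :: "('a, 'b) tensor \<Rightarrow> ('a, 'b) tensor \<Rightarrow> ('a, 'b) tensor" is "(-)"
proof -
  fix p p' q q' :: "'a \<times> 'b \<Rightarrow>\<^sub>0 complex" assume "tensor_eq p p'" "tensor_eq q q'"
  then have "(p - p') - (q - q') \<in> complex_vector.span tensor_relations"
    unfolding tensor_eq_def by (rule complex_vector.span_diff)
  then show "tensor_eq (p - q) (p' - q')" by (simp add: tensor_eq_def algebra_simps)
qed

lift_definition scaleC_tensor :: "complex \<Rightarrow> ('a, 'b) tensor \<Rightarrow> ('a, 'b) tensor" is scaleC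
  unfolding tensor_eq_def by (metis complex_vector.scale_right_diff_distrib complex_vector.span_scale)

instance
proof
  fix x y z :: "('a, 'b) tensor" and c d :: complex
  have eq: "tensor_eq p q" if "p = q" for p q :: "'a \<times> 'b \<Rightarrow>\<^sub>0 complex"
    using that by (simp add: equivp_reflp[OF tensor_eq_equivp])
  show "x + y + z = x + (y + z)" by transfer (auto intro!: eq simp: add.assoc)
  show "x + y = y + x" by transfer (auto intro!: eq simp: add.commute)
  show "0 + x = x" by transfer (auto intro!: eq)
  show "- x + x = 0" by transfer (auto intro!: eq)
  show "x - y = x + - y" by transfer (auto intro!: eq)
  show "c *\<^sub>C (x + y) = c *\<^sub>C x + c *\<^sub>C y" by transfer (auto intro!: eq simp: scaleC_add_right)
  show "(c + d) *\<^sub>C x = c *\<^sub>C x + d *\<^sub>C x" by transfer (auto intro!: eq simp: scaleC_add_left)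
  show "c *\<^sub>C (d *\<^sub>C x) = (c * d) *\<^sub>C x" by transfer (auto intro!: eq simp: scaleC_scaleC)
  show "1 *\<^sub>C x = x" by transfer (auto intro!: eq simp: scaleC_one)
qed

end

lift_definition tensor :: "'a::complex_vector \<Rightarrow> 'b::complex_vector \<Rightarrow> ('a, 'b) tensor"
    (infixr \<open>\<otimes>\<close> 72)
  is "\<lambda>a b. Poly_Mapping.single (a, b) 1" .

lemma tensor_linear:
  "(a + a') \<otimes> b = a \<otimes> b + a' \<otimes> b"
  "a \<otimes> (b + b') = a \<otimes> b + a \<otimes> b'"
  "(c *\<^sub>C a) \<otimes> b = c *\<^sub>C (a \<otimes> b)"
  "a \<otimes> (c *\<^sub>C b) = c *\<^sub>C (a \<otimes> b)"
  by (transfer; simp add: tensor_eq_def complex_vector.span_base tensor_relations.intros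
      flip: diff_diff_eq)+

lemma cbilinear_tensor: "cbilinear (\<otimes>)"
  unfolding cbilinear_def by (auto intro!: clinearI simp: tensor_linear)

lemma lin_ext_tensor_relations:
  assumes f: "cbilinear f" and p: "p \<in> complex_vector.span tensor_relations"
  shows "lin_ext (\<lambda>(a, b). f a b) p = 0"
  using p
proof (induction rule: complex_vector.span_induct)
  case base
  show ?case
    by (auto simp: complex_vector.subspace_def clinear_0[OF lin_ext_clinear]
        clinear_add[OF lin_ext_clinear] clinear_scaleC[OF lin_ext_clinear])
next
  case (step p)
  have 1: "f (a + a') b = f a b + f a' b" "f (c *\<^sub>C a) b = c *\<^sub>C f a b" for a a' b c
    using f clinear_add[of "\<lambda>x. f x b"] clinear_scaleC[of "\<lambda>x. f x b"]
    by (simp_all add: cbilinear_def)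
  have 2: "f a (b + b') = f a b + f a b'" "f a (c *\<^sub>C b) = c *\<^sub>C f a b" for a b b' c
    using f by (simp_all add: cbilinear_def clinear_add clinear_scaleC)
  from step show ?case
    by cases (simp_all add: 1 2 clinear_diff[OF lin_ext_clinear]
        clinear_scaleC[OF lin_ext_clinear] lin_ext_single scaleC_one)
qed

text \<open>The universal property: \<open>tensor_lift f\<close> is the linear map with \<open>a \<otimes> b \<mapsto> f a b\<close> for
  bilinear \<open>f\<close>.\<close>

lift_definition tensor_lift ::
    "('a::complex_vector \<Rightarrow> 'b::complex_vector \<Rightarrow> 'c::complex_vector) \<Rightarrow> ('a, 'b) tensor \<Rightarrow> 'c"
  is "\<lambda>f p. if cbilinear f then lin_ext (\<lambda>(a, b). f a b) p else 0"
proof -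
  fix f :: "'a \<Rightarrow> 'b \<Rightarrow> 'c" and p q :: "'a \<times> 'b \<Rightarrow>\<^sub>0 complex"
  assume "tensor_eq p q"
  then have "lin_ext (\<lambda>(a, b). f a b) (p - q) = 0" if "cbilinear f"
    using lin_ext_tensor_relations[OF that] by (simp add: tensor_eq_def)
  then show "(if cbilinear f then lin_ext (\<lambda>(a, b). f a b) p else 0) =
        (if cbilinear f then lin_ext (\<lambda>(a, b). f a b) q else 0)"
    by (simp add: clinear_diff[OF lin_ext_clinear])
qed

lemma tensor_lift_tensor: "cbilinear f \<Longrightarrow> tensor_lift f (a \<otimes> b) = f a b"
  by transfer (simp add: lin_ext_single scaleC_one)

lemma clinear_tensor_lift: "clinear (tensor_lift f)"
proof (rule clinearI)
  show "tensor_lift f (s + t) = tensor_lift f s + tensor_lift f t" for s t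
    by transfer (simp add: clinear_add[OF lin_ext_clinear])
  show "tensor_lift f (c *\<^sub>C s) = c *\<^sub>C tensor_lift f s" for c s
    by transfer (simp add: clinear_scaleC[OF lin_ext_clinear])
qed

lemma poly_mapping_complex_induct:
  fixes p :: "'k \<Rightarrow>\<^sub>0 complex"
  assumes "P 0" and "\<And>p q. P p \<Longrightarrow> P q \<Longrightarrow> P (p + q)"
    and "\<And>k c. P (c *\<^sub>C Poly_Mapping.single k 1)"
  shows "P p"
proof (induction p rule: update_induct)
  case const
  show ?case by (fact assms(1))
next
  case (update f a b)
  have "Poly_Mapping.update a b f = f + b *\<^sub>C Poly_Mapping.single a 1"
    using update.hyps
    by (intro poly_mapping_eqI)
      (auto simp: lookup_add lookup_update lookup_scaleC lookup_single scaleC_complex_def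
        in_keys_iff when_def)
  then show ?case using assms(2)[OF update.IH assms(3)] by simp
qed

lemma tensor_induct [case_names zero add tensor]:
  assumes "P 0" and "\<And>s t. P s \<Longrightarrow> P t \<Longrightarrow> P (s + t)" and "\<And>a b. P (a \<otimes> b)"
  shows "P t"
proof -
  have P: "P (c *\<^sub>C (a \<otimes> b))" for c a b using assms(3) by (simp flip: tensor_linear(3))
  obtain p where t: "t = abs_tensor p"
    using Quotient_tensor by (metis Quotient_abs_rep)
  have "P (abs_tensor p)"
  proof (induction p rule: poly_mapping_complex_induct)
    case 1
    show ?case using assms(1) by (simp add: zero_tensor_def)
  next
    case (2 p q)
    then show ?case using assms(2) by (metis plus_tensor.abs_eq)
  next
    case (3 k c)
    have "abs_tensor (c *\<^sub>C Poly_Mapping.single k 1) = c *\<^sub>C (fst k \<otimes> snd k)"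
      by (simp add: tensor.abs_eq scaleC_tensor.abs_eq)
    then show ?case using P by metis
  qed
  then show ?thesis by (simp add: t)
qed

lemma cbilinear_tensor_mult_inner:
  "cbilinear (\<lambda>(c::'a::complex_algebra) (d::'b::complex_algebra). (a * c) \<otimes> (b * d))"
  unfolding cbilinear_def
  by (auto intro!: clinearI simp: distrib_left mult_scaleC_right tensor_linear)

lemma cbilinear_tensor_mult_outer:
  "cbilinear (\<lambda>(a::'a::complex_algebra) (b::'b::complex_algebra).
     tensor_lift (\<lambda>c d. (a * c) \<otimes> (b * d)) t)"
proof -
  let ?L = "\<lambda>a b. tensor_lift (\<lambda>(c::'a) (d::'b). (a * c) \<otimes> (b * d))"
  note T = tensor_lift_tensor[OF cbilinear_tensor_mult_inner]
  note L = clinear_add[OF clinear_tensor_lift] clinear_0[OF clinear_tensor_lift]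
    complex_vector.scale_zero_right add_0_left
  have "?L (a + a') b t = ?L a b t + ?L a' b t" "?L (k *\<^sub>C a) b t = k *\<^sub>C ?L a b t"
    "?L a (b + b') t = ?L a b t + ?L a b' t" "?L a (k *\<^sub>C b) t = k *\<^sub>C ?L a b t"
    for a a' b b' k
    by (induction t rule: tensor_induct;
        simp only: L T; simp add: distrib_right mult_scaleC_left tensor_linear scaleC_add_right)+
  then show ?thesis unfolding cbilinear_def by (auto intro!: clinearI)
qed

instantiation tensor :: (complex_algebra, complex_algebra) complex_algebra
begin

definition one_tensor :: "('a, 'b) tensor" where
  "one_tensor = 1 \<otimes> 1"

text \<open>The bilinear extension of \<open>(a \<otimes> b) * (c \<otimes> d) = (a * c) \<otimes> (b * d)\<close>.\<close>

definition times_tensor :: "('a, 'b) tensor \<Rightarrow> ('a, 'b) tensor \<Rightarrow> ('a, 'b) tensor" where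
  "times_tensor s t = tensor_lift (\<lambda>a b. tensor_lift (\<lambda>c d. (a * c) \<otimes> (b * d)) t) s"

instance
proof
  fix x y z :: "('a, 'b) tensor" and k :: complex
  have l: "(x + y) * z = x * z + y * z" "(k *\<^sub>C x) * y = k *\<^sub>C (x * y)" "0 * x = 0"
    for x y z :: "('a, 'b) tensor" and k
    by (simp_all add: times_tensor_def clinear_add[OF clinear_tensor_lift]
        clinear_scaleC[OF clinear_tensor_lift] clinear_0[OF clinear_tensor_lift])
  have T1: "(a \<otimes> b) * t = tensor_lift (\<lambda>c d. (a * c) \<otimes> (b * d)) t" for a b and t :: "('a, 'b) tensor"
    unfolding times_tensor_def by (rule tensor_lift_tensor[OF cbilinear_tensor_mult_outer])
  have T: "(a \<otimes> b) * (c \<otimes> d) = (a * c) \<otimes> (b * d)" for a c :: 'a and b d :: 'b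
    unfolding T1 by (rule tensor_lift_tensor[OF cbilinear_tensor_mult_inner])
  have r: "x * (y + z) = x * y + x * z" for x y z :: "('a, 'b) tensor"
    by (induction x rule: tensor_induct)
      (simp_all add: l T1 clinear_add[OF clinear_tensor_lift] algebra_simps)
  have rs: "x * (k *\<^sub>C y) = k *\<^sub>C (x * y)" for x y :: "('a, 'b) tensor" and k
    by (induction x rule: tensor_induct)
      (simp_all add: l T1 clinear_scaleC[OF clinear_tensor_lift] scaleC_add_right)
  have r0: "x * 0 = 0" for x :: "('a, 'b) tensor"
    using r[of x 0 0] by simp
  show "(x + y) * z = x * z + y * z" "x * (y + z) = x * y + x * z"
    "(k *\<^sub>C x) * y = k *\<^sub>C (x * y)" "x * (k *\<^sub>C y) = k *\<^sub>C (x * y)"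
    by (rule l r rs)+
  have a1: "(a \<otimes> b) * (c \<otimes> d) * z = (a \<otimes> b) * ((c \<otimes> d) * z)" for a b c d
    by (induction z rule: tensor_induct) (simp_all add: r r0 T mult.assoc)
  have a2: "(a \<otimes> b) * y * z = (a \<otimes> b) * (y * z)" for a b
    by (induction y rule: tensor_induct) (simp_all add: r r0 l a1)
  show "x * y * z = x * (y * z)"
    by (induction x rule: tensor_induct) (simp_all add: l a2)
  show "1 * x = x"
    by (induction x rule: tensor_induct) (simp_all add: one_tensor_def r r0 T)
  show "x * 1 = x"
    by (induction x rule: tensor_induct) (simp_all add: one_tensor_def l T)
qed

end


section \<open>Lie algebras and universal enveloping algebras\<close>

class lie_algebra = complex_vector +
  fixes lie_bracket :: "'a \<Rightarrow> 'a \<Rightarrow> 'a"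
  assumes lie_bracket_add_left: "lie_bracket (x + y) z = lie_bracket x z + lie_bracket y z"
    and lie_bracket_add_right: "lie_bracket x (y + z) = lie_bracket x y + lie_bracket x z"
    and lie_bracket_scaleC_left: "lie_bracket (c *\<^sub>C x) y = c *\<^sub>C lie_bracket x y"
    and lie_bracket_scaleC_right: "lie_bracket x (c *\<^sub>C y) = c *\<^sub>C lie_bracket x y"
    and lie_bracket_self: "lie_bracket x x = 0"
    and jacobi: "lie_bracket x (lie_bracket y z) + lie_bracket y (lie_bracket z x)
        + lie_bracket z (lie_bracket x y) = 0"

lemma lie_bracket_skew: "lie_bracket y x = - lie_bracket (x::'a::lie_algebra) y"
proof -
  have "lie_bracket x y + lie_bracket y x = lie_bracket (x + y) (x + y)"
    by (simp only: lie_bracket_add_left lie_bracket_add_right) (simp add: lie_bracket_self)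
  then have "lie_bracket x y + lie_bracket y x = 0" by (simp add: lie_bracket_self)
  then show ?thesis by (simp add: eq_neg_iff_add_eq_0 add.commute)
qed

text \<open>Words over \<open>'a\<close> form the free monoid, written additively so that
  \<open>'a free_monoid \<Rightarrow>\<^sub>0 complex\<close>, with the convolution product of
  \<^theory>\<open>HOL-Library.Poly_Mapping\<close>, is the free associative unital algebra on the set \<open>'a\<close>.\<close>

datatype 'a free_monoid = Word (letters: "'a list")

instantiation free_monoid :: (type) monoid_add
begin
definition zero_free_monoid :: "'a free_monoid" where
  "zero_free_monoid = Word []"
definition plus_free_monoid :: "'a free_monoid \<Rightarrow> 'a free_monoid \<Rightarrow> 'a free_monoid" where
  "plus_free_monoid u v = Word (letters u @ letters v)"
instance by standard (simp_all add: zero_free_monoid_def plus_free_monoid_def)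
end

type_synonym 'a free_algebra = "'a free_monoid \<Rightarrow>\<^sub>0 complex"

definition free_gen :: "'a \<Rightarrow> 'a free_algebra" where
  "free_gen x = Poly_Mapping.single (Word [x]) 1"

inductive_set two_sided_ideal :: "'r::ring set \<Rightarrow> 'r set" for S where
  zero: "0 \<in> two_sided_ideal S"
| base: "s \<in> S \<Longrightarrow> s \<in> two_sided_ideal S"
| add: "p \<in> two_sided_ideal S \<Longrightarrow> q \<in> two_sided_ideal S \<Longrightarrow> p + q \<in> two_sided_ideal S"
| mult_left: "p \<in> two_sided_ideal S \<Longrightarrow> r * p \<in> two_sided_ideal S"
| mult_right: "p \<in> two_sided_ideal S \<Longrightarrow> p * r \<in> two_sided_ideal S"

text \<open>The first two relations turn the free algebra on the set \<open>'a\<close> into the tensor algebra of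
  the vector space \<open>'a\<close>.\<close>

inductive_set uea_relations :: "('a::lie_algebra) free_algebra set" where
  "free_gen (x + y) - free_gen x - free_gen y \<in> uea_relations"
| "free_gen (c *\<^sub>C x) - c *\<^sub>C free_gen x \<in> uea_relations"
| "free_gen x * free_gen y - free_gen y * free_gen x - free_gen (lie_bracket x y) \<in> uea_relations"

definition uea_eq :: "('a::lie_algebra) free_algebra \<Rightarrow> 'a free_algebra \<Rightarrow> bool" where
  "uea_eq p q \<longleftrightarrow> p - q \<in> two_sided_ideal uea_relations"

lemma two_sided_ideal_uminus:
  "p \<in> two_sided_ideal S \<Longrightarrow> - p \<in> two_sided_ideal (S :: 'r::ring_1 set)"
  using two_sided_ideal.mult_left[of p S "- 1"] by simp

lemma uea_eq_equivp: "equivp (uea_eq :: ('a::lie_algebra) free_algebra \<Rightarrow> _)"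
proof (rule equivpI)
  show "reflp (uea_eq :: 'a free_algebra \<Rightarrow> _)" by (auto simp: reflp_def uea_eq_def two_sided_ideal.zero)
  show "symp (uea_eq :: 'a free_algebra \<Rightarrow> _)"
    using two_sided_ideal_uminus by (fastforce simp: symp_def uea_eq_def)
  show "transp (uea_eq :: 'a free_algebra \<Rightarrow> _)"
  proof (rule transpI)
    fix p q r :: "'a free_algebra" assume "uea_eq p q" "uea_eq q r"
    then have "(p - q) + (q - r) \<in> two_sided_ideal uea_relations"
      unfolding uea_eq_def by (rule two_sided_ideal.add)
    then show "uea_eq p r" by (simp add: uea_eq_def)
  qed
qed

lemma scaleC_free_algebra: "c *\<^sub>C p = Poly_Mapping.single 0 c * (p :: 'a free_algebra)"
proof (induction p rule: poly_mapping_complex_induct)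
  case 1
  then show ?case by simp
next
  case (2 p q)
  then show ?case by (simp add: scaleC_add_right distrib_left)
next
  case (3 k d)
  have s: "c *\<^sub>C Poly_Mapping.single k d = Poly_Mapping.single k (c * d)"
    for c d and k :: "'a free_monoid"
    by (rule poly_mapping_eqI)
      (simp add: lookup_scaleC lookup_single scaleC_complex_def when_def)
  show ?case by (simp add: s mult_single)
qed

lemma scaleC_free_algebra': "c *\<^sub>C p = (p :: 'a free_algebra) * Poly_Mapping.single 0 c"
proof (induction p rule: poly_mapping_complex_induct)
  case 1
  then show ?case by simp
next
  case (2 p q)
  then show ?case by (simp add: scaleC_add_right distrib_right)
next
  case (3 k d)
  have s: "c *\<^sub>C Poly_Mapping.single k d = Poly_Mapping.single k (c * d)"
    for c d and k :: "'a free_monoid"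
    by (rule poly_mapping_eqI)
      (simp add: lookup_scaleC lookup_single scaleC_complex_def when_def)
  show ?case by (simp add: s mult_single mult.commute)
qed

quotient_type (overloaded) 'a uea = "('a::lie_algebra) free_monoid \<Rightarrow>\<^sub>0 complex" / uea_eq
  by (rule uea_eq_equivp)

instantiation uea :: (lie_algebra) complex_algebra
begin

lift_definition zero_uea :: "'a uea" is 0 .

lift_definition one_uea :: "'a uea" is 1 .

lift_definition plus_uea :: "'a uea \<Rightarrow> 'a uea \<Rightarrow> 'a uea" is "(+)"
  unfolding uea_eq_def by (metis add_diff_add two_sided_ideal.add)

lift_definition uminus_uea :: "'a uea \<Rightarrow> 'a uea" is uminus
  unfolding uea_eq_def using two_sided_ideal_uminus by (metis minus_diff_minus)

lift_definition minus_uea :: "'a uea \<Rightarrow> 'a uea \<Rightarrow> 'a uea" is "(-)"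
proof -
  fix p p' q q' :: "'a free_algebra" assume "uea_eq p p'" "uea_eq q q'"
  then have "(p - p') + - (q - q') \<in> two_sided_ideal uea_relations"
    unfolding uea_eq_def by (intro two_sided_ideal.add two_sided_ideal_uminus)
  then show "uea_eq (p - q) (p' - q')" by (simp add: uea_eq_def algebra_simps)
qed

lift_definition times_uea :: "'a uea \<Rightarrow> 'a uea \<Rightarrow> 'a uea" is "(*)"
proof -
  fix p p' q q' :: "'a free_algebra" assume "uea_eq p p'" "uea_eq q q'"
  then have "(p - p') * q + p' * (q - q') \<in> two_sided_ideal uea_relations"
    unfolding uea_eq_def by (intro two_sided_ideal.intros(3-5))
  then show "uea_eq (p * q) (p' * q')" by (simp add: uea_eq_def algebra_simps)
qed

lift_definition scaleC_uea :: "complex \<Rightarrow> 'a uea \<Rightarrow> 'a uea" is scaleC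
proof -
  fix c and p q :: "'a free_algebra" assume "uea_eq p q"
  then show "uea_eq (c *\<^sub>C p) (c *\<^sub>C q)"
    unfolding uea_eq_def scaleC_free_algebra
    by (metis two_sided_ideal.mult_left right_diff_distrib)
qed

instance
proof
  fix x y z :: "'a uea" and c d :: complex
  have eq: "uea_eq p q" if "p = q" for p q :: "'a free_algebra"
    using that by (simp add: equivp_reflp[OF uea_eq_equivp])
  show "x + y + z = x + (y + z)" by transfer (auto intro!: eq simp: add.assoc)
  show "x + y = y + x" by transfer (auto intro!: eq simp: add.commute)
  show "0 + x = x" by transfer (auto intro!: eq)
  show "- x + x = 0" by transfer (auto intro!: eq)
  show "x - y = x + - y" by transfer (auto intro!: eq)
  show "c *\<^sub>C (x + y) = c *\<^sub>C x + c *\<^sub>C y" by transfer (auto intro!: eq simp: scaleC_add_right)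
  show "(c + d) *\<^sub>C x = c *\<^sub>C x + d *\<^sub>C x" by transfer (auto intro!: eq simp: scaleC_add_left)
  show "c *\<^sub>C (d *\<^sub>C x) = (c * d) *\<^sub>C x" by transfer (auto intro!: eq simp: scaleC_scaleC)
  show "1 *\<^sub>C x = x" by transfer (auto intro!: eq simp: scaleC_one)
  show "x * y * z = x * (y * z)" by transfer (auto intro!: eq simp: mult.assoc)
  show "(x + y) * z = x * z + y * z" by transfer (auto intro!: eq simp: distrib_right)
  show "x * (y + z) = x * y + x * z" by transfer (auto intro!: eq simp: distrib_left)
  show "1 * x = x" by transfer (auto intro!: eq)
  show "x * 1 = x" by transfer (auto intro!: eq)
  show "(c *\<^sub>C x) * y = c *\<^sub>C (x * y)"
    by transfer (auto intro!: eq simp: scaleC_free_algebra mult.assoc)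
  show "x * (c *\<^sub>C y) = c *\<^sub>C (x * y)"
    by transfer (auto intro!: eq simp: scaleC_free_algebra' mult.assoc)
qed

end

lift_definition uea_incl :: "'a::lie_algebra \<Rightarrow> 'a uea" is free_gen .

lemma clinear_uea_incl: "clinear uea_incl"
proof (rule clinearI)
  show "uea_incl (x + y) = uea_incl x + uea_incl y" for x y :: 'a
    by transfer (simp add: uea_eq_def two_sided_ideal.base uea_relations.intros
        flip: diff_diff_eq)
  show "uea_incl (c *\<^sub>C x) = c *\<^sub>C uea_incl x" for c and x :: 'a
    by transfer (simp add: uea_eq_def two_sided_ideal.base uea_relations.intros)
qed

lemma commutator_uea_incl:
  "commutator (uea_incl x) (uea_incl y) = uea_incl (lie_bracket x y)"
  unfolding commutator_def
  by transfer (simp add: uea_eq_def two_sided_ideal.base uea_relations.intros)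


section \<open>The classical Yang--Baxter equation\<close>

text \<open>The third tensor power of \<open>U(h)\<close> is taken as \<open>U(h) \<otimes> (U(h) \<otimes> U(h))\<close>.\<close>

type_synonym 'a uea3 = "('a uea, ('a uea, 'a uea) tensor) tensor"

definition r12 :: "('a::lie_algebra, 'a) tensor \<Rightarrow> 'a uea3" where
  "r12 = tensor_lift (\<lambda>a b. uea_incl a \<otimes> uea_incl b \<otimes> 1)"

definition r13 :: "('a::lie_algebra, 'a) tensor \<Rightarrow> 'a uea3" where
  "r13 = tensor_lift (\<lambda>a b. uea_incl a \<otimes> 1 \<otimes> uea_incl b)"

definition r23 :: "('a::lie_algebra, 'a) tensor \<Rightarrow> 'a uea3" where
  "r23 = tensor_lift (\<lambda>a b. 1 \<otimes> uea_incl a \<otimes> uea_incl b)"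

text \<open>The maps lifted above are bilinear, so the default value of \<^const>\<open>tensor_lift\<close> is not used.\<close>

lemma r12_r13_r23_tensor:
  "r12 (a \<otimes> b) = uea_incl a \<otimes> uea_incl b \<otimes> 1"
  "r13 (a \<otimes> b) = uea_incl a \<otimes> 1 \<otimes> uea_incl b"
  "r23 (a \<otimes> b) = 1 \<otimes> uea_incl a \<otimes> uea_incl b"
proof -
  note I = clinear_add[OF clinear_uea_incl] clinear_scaleC[OF clinear_uea_incl]
  show "r12 (a \<otimes> b) = uea_incl a \<otimes> uea_incl b \<otimes> 1"
    unfolding r12_def
    by (rule tensor_lift_tensor) (auto simp: cbilinear_def I tensor_linear intro!: clinearI)
  show "r13 (a \<otimes> b) = uea_incl a \<otimes> 1 \<otimes> uea_incl b"
    unfolding r13_def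
    by (rule tensor_lift_tensor) (auto simp: cbilinear_def I tensor_linear intro!: clinearI)
  show "r23 (a \<otimes> b) = 1 \<otimes> uea_incl a \<otimes> uea_incl b"
    unfolding r23_def
    by (rule tensor_lift_tensor) (auto simp: cbilinear_def I tensor_linear intro!: clinearI)
qed

definition CYBE_solution :: "('a::lie_algebra, 'a) tensor \<Rightarrow> bool" where
  "CYBE_solution r \<longleftrightarrow>
     commutator (r12 r) (r13 r) + commutator (r12 r) (r23 r) + commutator (r13 r) (r23 r) = 0"


section \<open>The coadjoint representation and its semidirect product\<close>

typedef (overloaded) 'a dual = "{f :: 'a::complex_vector \<Rightarrow> complex. clinear f}"
  morphisms dual_apply Abs_dual
  by (rule exI[of _ "\<lambda>_. 0"]) (auto intro!: clinearI)

setup_lifting type_definition_dual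

instantiation dual :: (complex_vector) complex_vector
begin

lift_definition zero_dual :: "'a dual" is "\<lambda>_. 0"
  by (auto intro!: clinearI)

lift_definition plus_dual :: "'a dual \<Rightarrow> 'a dual \<Rightarrow> 'a dual" is "\<lambda>f g x. f x + g x"
  by (auto intro!: clinearI simp: clinear_add clinear_scaleC scaleC_add_right)

lift_definition uminus_dual :: "'a dual \<Rightarrow> 'a dual" is "\<lambda>f x. - f x"
  by (auto intro!: clinearI simp: clinear_add clinear_scaleC)

lift_definition minus_dual :: "'a dual \<Rightarrow> 'a dual \<Rightarrow> 'a dual" is "\<lambda>f g x. f x - g x"
  by (auto intro!: clinearI simp: clinear_add clinear_scaleC complex_vector.scale_right_diff_distrib)

lift_definition scaleC_dual :: "complex \<Rightarrow> 'a dual \<Rightarrow> 'a dual" is "\<lambda>c f x. c * f x"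
  by (auto intro!: clinearI simp: clinear_add clinear_scaleC scaleC_complex_def algebra_simps)

instance by standard (transfer; simp add: fun_eq_iff algebra_simps)+

end

lift_definition coad :: "'a::lie_algebra \<Rightarrow> 'a dual \<Rightarrow> 'a dual" is "\<lambda>x \<xi> y. - \<xi> (lie_bracket x y)"
  by (auto intro!: clinearI simp: clinear_add clinear_scaleC lie_bracket_add_right
      lie_bracket_scaleC_right)

lemma coad_linear:
  "coad (x + y) \<xi> = coad x \<xi> + coad y \<xi>" "coad (c *\<^sub>C x) \<xi> = c *\<^sub>C coad x \<xi>"
  "coad x (\<xi> + \<eta>) = coad x \<xi> + coad x \<eta>" "coad x (c *\<^sub>C \<xi>) = c *\<^sub>C coad x \<xi>"
  by (transfer; auto simp: fun_eq_iff clinear_add clinear_scaleC lie_bracket_add_left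
      lie_bracket_scaleC_left scaleC_complex_def)+

lemma coad_lie_bracket: "coad (lie_bracket x y) \<xi> = coad x (coad y \<xi>) - coad y (coad x \<xi>)"
proof (transfer, rule ext)
  fix x y z :: 'a and \<xi> :: "'a \<Rightarrow> complex" assume \<xi>: "clinear \<xi>"
  have "lie_bracket (lie_bracket x y) z =
      lie_bracket x (lie_bracket y z) - lie_bracket y (lie_bracket x z)"
  proof -
    have m: "lie_bracket u (- v) = - lie_bracket u v" for u v :: 'a
      using lie_bracket_scaleC_right[of u "-1" v] by simp
    show ?thesis
      using jacobi[of x y z] lie_bracket_skew[of z "lie_bracket x y"] lie_bracket_skew[of z x]
      by (simp add: m algebra_simps add_eq_0_iff)
  qed
  then show "- \<xi> (lie_bracket (lie_bracket x y) z) =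
      - (- \<xi> (lie_bracket y (lie_bracket x z))) - - (- \<xi> (lie_bracket x (lie_bracket y z)))"
    by (simp add: clinear_diff[OF \<xi>])
qed

text \<open>\<open>Semi x \<xi>\<close> is the element \<open>x + \<xi>\<close> of the direct sum of \<open>'a\<close> and its dual.\<close>

context notes [[typedef_overloaded]]
begin
datatype 'a coad_semidirect = Semi (base_part: "'a::complex_vector") (dual_part: "'a dual")
end

instantiation coad_semidirect :: (complex_vector) complex_vector
begin

definition zero_coad_semidirect :: "'a coad_semidirect" where
  "0 = Semi 0 0"
definition plus_coad_semidirect ::
    "'a coad_semidirect \<Rightarrow> 'a coad_semidirect \<Rightarrow> 'a coad_semidirect" where
  "s + t = Semi (base_part s + base_part t) (dual_part s + dual_part t)"
definition uminus_coad_semidirect :: "'a coad_semidirect \<Rightarrow> 'a coad_semidirect" where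
  "- s = Semi (- base_part s) (- dual_part s)"
definition minus_coad_semidirect ::
    "'a coad_semidirect \<Rightarrow> 'a coad_semidirect \<Rightarrow> 'a coad_semidirect" where
  "s - t = Semi (base_part s - base_part t) (dual_part s - dual_part t)"
definition scaleC_coad_semidirect :: "complex \<Rightarrow> 'a coad_semidirect \<Rightarrow> 'a coad_semidirect" where
  "c *\<^sub>C s = Semi (c *\<^sub>C base_part s) (c *\<^sub>C dual_part s)"

instance
  by standard
    (simp_all add: zero_coad_semidirect_def plus_coad_semidirect_def uminus_coad_semidirect_def
      minus_coad_semidirect_def scaleC_coad_semidirect_def algebra_simps scaleC_add_right
      scaleC_add_left scaleC_scaleC scaleC_one)

end

instantiation coad_semidirect :: (lie_algebra) lie_algebra
begin

definition lie_bracket_coad_semidirect ::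
    "'a coad_semidirect \<Rightarrow> 'a coad_semidirect \<Rightarrow> 'a coad_semidirect" where
  "lie_bracket s t =
     Semi (lie_bracket (base_part s) (base_part t))
       (coad (base_part s) (dual_part t) - coad (base_part t) (dual_part s))"

instance
proof
  fix x y z :: "'a coad_semidirect" and c :: complex
  note defs = zero_coad_semidirect_def plus_coad_semidirect_def scaleC_coad_semidirect_def
    lie_bracket_coad_semidirect_def
  show "lie_bracket (x + y) z = lie_bracket x z + lie_bracket y z"
    by (simp add: defs lie_bracket_add_left coad_linear)
  show "lie_bracket x (y + z) = lie_bracket x y + lie_bracket x z"
    by (simp add: defs lie_bracket_add_right coad_linear)
  show "lie_bracket (c *\<^sub>C x) y = c *\<^sub>C lie_bracket x y"
    by (simp add: defs lie_bracket_scaleC_left coad_linear complex_vector.scale_right_diff_distrib)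
  show "lie_bracket x (c *\<^sub>C y) = c *\<^sub>C lie_bracket x y"
    by (simp add: defs lie_bracket_scaleC_right coad_linear complex_vector.scale_right_diff_distrib)
  show "lie_bracket x x = 0" by (simp add: defs lie_bracket_self)
  have d: "coad u (\<xi> - \<eta>) = coad u \<xi> - coad u \<eta>" for u :: 'a and \<xi> \<eta>
    using coad_linear(3)[of u "\<xi> - \<eta>" \<eta>] by (simp add: algebra_simps)
  show "lie_bracket x (lie_bracket y z) + lie_bracket y (lie_bracket z x)
      + lie_bracket z (lie_bracket x y) = 0"
    by (simp add: defs jacobi d coad_lie_bracket)
qed

end

definition of_base :: "'a::complex_vector \<Rightarrow> 'a coad_semidirect" where
  "of_base x = Semi x 0"

definition of_dual :: "'a::complex_vector dual \<Rightarrow> 'a coad_semidirect" where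
  "of_dual \<xi> = Semi 0 \<xi>"

end

(* The elements e_1^* and e_2^* are central in the semidirect product, and in each of the six cases the
   components of r along e_1, e_2, e_3 commute with each other.  Hence the legs of r lie in an abelian
   subalgebra, and each of the three commutators in the Yang-Baxter equation vanishes separately. *)
theory Submission
  imports Defs
begin

section \<open>Commuting legs and the Yang-Baxter equation\<close>

lemma tensor_mult_tensor:
  fixes a c :: "'a::complex_algebra" and b d :: "'b::complex_algebra"
  shows "(a \<otimes> b) * (c \<otimes> d) = (a * c) \<otimes> (b * d)"
  unfolding times_tensor_def tensor_lift_tensor[OF cbilinear_tensor_mult_outer]
  by (rule tensor_lift_tensor[OF cbilinear_tensor_mult_inner])

lemma clinear_r12_r13_r23: "clinear r12" "clinear r13" "clinear r23"
  unfolding r12_def r13_def r23_def by (rule clinear_tensor_lift)+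

text \<open>Commuting with a fixed element is a linear condition, so it passes from a generating set
  to its span. This is applied once in the argument of \<open>g\<close>, with \<open>s\<close> still
  a generator, and then once in the argument of \<open>f\<close>.\<close>

lemma commute_span:
  fixes f :: "'a::complex_vector \<Rightarrow> 'c::complex_algebra" and g :: "'b::complex_vector \<Rightarrow> 'c"
  assumes f: "clinear f" and g: "clinear g"
    and comm: "\<And>s t. s \<in> S \<Longrightarrow> t \<in> T \<Longrightarrow> f s * g t = g t * f s"
    and s: "s \<in> complex_vector.span S" and t: "t \<in> complex_vector.span T"
  shows "f s * g t = g t * f s"
proof -
  have "f s * g t = g t * f s" if "s \<in> S" for s
    using t
  proof (induction rule: complex_vector.span_induct)
    case base
    show ?case
      by (auto simp: complex_vector.subspace_def clinear_0[OF g] clinear_add[OF g]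
          clinear_scaleC[OF g] distrib_left distrib_right mult_scaleC_left mult_scaleC_right)
  qed (simp add: comm that)
  from s this show ?thesis
  proof (induction rule: complex_vector.span_induct)
    case base
    show ?case
      by (auto simp: complex_vector.subspace_def clinear_0[OF f] clinear_add[OF f]
          clinear_scaleC[OF f] distrib_left distrib_right mult_scaleC_left mult_scaleC_right)
  qed
qed

text \<open>For generators \<open>x \<otimes> y\<close>, two of the images under \<open>r12\<close>,
  \<open>r13\<close>, \<open>r23\<close> share exactly one tensor slot in which neither has the
  factor 1. The products in the two orders can differ only there, and in \<open>U(h)\<close> the two
  entries commute because their Lie bracket is 0.\<close>

lemma CYBE_solution_abelian:
  assumes abelian: "\<And>x y. x \<in> A \<Longrightarrow> y \<in> A \<Longrightarrow> lie_bracket x y = 0"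
    and r: "r \<in> complex_vector.span {x \<otimes> y | x y. x \<in> A \<and> y \<in> A}"
  shows "CYBE_solution r"
proof -
  have comm: "uea_incl x * uea_incl y = uea_incl y * uea_incl x" if "x \<in> A" "y \<in> A" for x y
    using commutator_uea_incl[of x y] abelian[OF that]
    by (simp add: commutator_def clinear_0[OF clinear_uea_incl])
  note r12_r13_r23_tensor [simp] tensor_mult_tensor [simp]
  \<comment> \<open>The shared slot is the first one here, the second for \<open>r12\<close> and
    \<open>r23\<close>, and the third for \<open>r13\<close> and \<open>r23\<close>.\<close>
  have "r12 r * r13 r = r13 r * r12 r"
    by (rule commute_span[OF clinear_r12_r13_r23(1,2) _ r r]) (auto simp: comm)
  moreover have "r12 r * r23 r = r23 r * r12 r"
    by (rule commute_span[OF clinear_r12_r13_r23(1,3) _ r r]) (auto simp: comm)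
  moreover have "r13 r * r23 r = r23 r * r13 r"
    by (rule commute_span[OF clinear_r12_r13_r23(2,3) _ r r]) (auto simp: comm)
  ultimately show ?thesis by (simp add: CYBE_solution_def commutator_def)
qed

text \<open>This is the common shape of all six solutions: one of \<open>u\<close>, \<open>v\<close>
  is 0 in the first and third, and \<open>v\<close> is a multiple of \<open>u\<close> in the last
  two.\<close>

lemma CYBE_solution_skew:
  assumes "\<And>x y. x \<in> {u, v, p, q} \<Longrightarrow> y \<in> {u, v, p, q} \<Longrightarrow> lie_bracket x y = 0"
  shows "CYBE_solution (u \<otimes> p + v \<otimes> q - p \<otimes> u - q \<otimes> v)"
proof (rule CYBE_solution_abelian[OF assms])
  let ?T = "{x \<otimes> y | x y. x \<in> {u, v, p, q} \<and> y \<in> {u, v, p, q}}"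
  have "u \<otimes> p \<in> ?T" "v \<otimes> q \<in> ?T" "p \<otimes> u \<in> ?T" "q \<otimes> v \<in> ?T" by blast+
  then show "u \<otimes> p + v \<otimes> q - p \<otimes> u - q \<otimes> v \<in> complex_vector.span ?T"
    by (intro complex_vector.span_diff complex_vector.span_add complex_vector.span_base)
qed

section \<open>Independence, spanning sets and functionals\<close>

text \<open>A functional that vanishes on the other members of \<open>B\<close> vanishes on their
  span, so \<open>b\<close> with \<open>f b \<noteq> 0\<close> cannot lie in that span.\<close>

lemma independent_if_separated:
  assumes sep: "\<And>b. b \<in> B \<Longrightarrow>
    \<exists>f :: 'a::complex_vector \<Rightarrow> complex. clinear f \<and> f b \<noteq> 0 \<and> (\<forall>x \<in> B - {b}. f x = 0)"
  shows "complex_vector.independent B"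
proof
  assume "complex_vector.dependent B"
  then obtain b where b: "b \<in> B" "b \<in> complex_vector.span (B - {b})"
    by (auto simp: complex_vector.dependent_def)
  from sep[OF b(1)] obtain f :: "'a \<Rightarrow> complex"
    where f: "clinear f" "f b \<noteq> 0" "\<And>x. x \<in> B - {b} \<Longrightarrow> f x = 0" by blast
  from b(2) have "f b = 0"
  proof (induction rule: complex_vector.span_induct)
    case base
    show ?case
      by (auto simp: complex_vector.subspace_def clinear_0[OF f(1)] clinear_add[OF f(1)]
          clinear_scaleC[OF f(1)])
  qed (rule f(3))
  with f(2) show False by contradiction
qed

lemma clinear_eq_on_spanning:
  assumes "clinear f" "clinear g" "complex_vector.span B = UNIV" "\<And>b. b \<in> B \<Longrightarrow> f b = g b"
  shows "f x = g x"
proof -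
  interpret vector_space_pair "scaleC :: complex \<Rightarrow> 'a \<Rightarrow> 'a" "scaleC :: complex \<Rightarrow> 'b \<Rightarrow> 'b" ..
  show ?thesis using assms linear_eq_on_span[of f g B x] by auto
qed

lemma clinear_dual_apply: "clinear (dual_apply \<xi>)"
  using dual_apply by blast

lemmas dual_apply_linear [simp] =
  clinear_add[OF clinear_dual_apply] clinear_diff[OF clinear_dual_apply]
  clinear_scaleC[OF clinear_dual_apply] clinear_0[OF clinear_dual_apply]

lemmas dual_apply_simps [simp] =
  zero_dual.rep_eq plus_dual.rep_eq uminus_dual.rep_eq minus_dual.rep_eq scaleC_dual.rep_eq
  coad.rep_eq

text \<open>Turns identities between functionals, such as the coadjoint table below, into a finite
  check on basis vectors.\<close>

lemma dual_eq_on_spanning: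
  assumes "complex_vector.span B = UNIV" "\<And>b. b \<in> B \<Longrightarrow> dual_apply \<xi> b = dual_apply \<eta> b"
  shows "\<xi> = \<eta>"
  using clinear_eq_on_spanning[OF clinear_dual_apply clinear_dual_apply assms]
  by (simp add: dual_apply_inject[symmetric] fun_eq_iff)

section \<open>Brackets and coordinates in the semidirect product\<close>

lemma lie_bracket_of_base_of_dual:
  "lie_bracket (of_base x) (of_base y) = of_base (lie_bracket x y)"
  "lie_bracket (of_base x) (of_dual \<xi>) = of_dual (coad x \<xi>)"
  "lie_bracket (of_dual \<xi>) (of_base x) = - of_dual (coad x \<xi>)"
  "lie_bracket (of_dual \<xi>) (of_dual \<eta>) = 0"
proof -
  \<comment> \<open>Homogeneity with the scalar 0 gives these values.\<close>
  have zero: "lie_bracket 0 x = 0" "lie_bracket x 0 = 0" "coad 0 \<xi> = 0" "coad x 0 = 0"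
    for x :: 'a and \<xi>
    using lie_bracket_scaleC_left[of 0 0 x] lie_bracket_scaleC_right[of x 0 0]
      coad_linear(2)[of 0 0 \<xi>] coad_linear(4)[of x 0 0]
    by simp_all
  show "lie_bracket (of_base x) (of_base y) = of_base (lie_bracket x y)"
    "lie_bracket (of_base x) (of_dual \<xi>) = of_dual (coad x \<xi>)"
    "lie_bracket (of_dual \<xi>) (of_base x) = - of_dual (coad x \<xi>)"
    "lie_bracket (of_dual \<xi>) (of_dual \<eta>) = 0"
    by (simp_all add: lie_bracket_coad_semidirect_def of_base_def of_dual_def
        zero_coad_semidirect_def uminus_coad_semidirect_def zero)
qed

lemma clinear_of_base: "clinear of_base"
  by (rule clinearI) (simp_all add: of_base_def plus_coad_semidirect_def scaleC_coad_semidirect_def)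

lemma clinear_of_dual: "clinear of_dual"
  by (rule clinearI) (simp_all add: of_dual_def plus_coad_semidirect_def scaleC_coad_semidirect_def)

lemma of_dual_uminus: "of_dual (- \<xi>) = - of_dual \<xi>"
  by (simp add: of_dual_def uminus_coad_semidirect_def)

text \<open>With the next lemma, this supplies the coordinate functionals that separate the six
  basis vectors.\<close>

lemma clinear_dual_apply_base_part: "clinear (\<lambda>s. dual_apply \<xi> (base_part s))"
  by (rule clinearI) (simp_all add: plus_coad_semidirect_def scaleC_coad_semidirect_def)

lemma clinear_dual_apply_dual_part: "clinear (\<lambda>s. dual_apply (dual_part s) x)"
  by (rule clinearI)
    (simp_all add: plus_coad_semidirect_def scaleC_coad_semidirect_def scaleC_complex_def)

theorem proposition5p17:
  fixes e1 e2 e3 :: "'g::lie_algebra" and d1 d2 d3 :: "'g dual"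
    and E1 E2 E3 D1 D2 D3 :: "'g coad_semidirect"
  assumes basis: "distinct [e1, e2, e3]" "complex_vector.independent {e1, e2, e3}"
      "complex_vector.span {e1, e2, e3} = UNIV"
    and bracket: "lie_bracket e1 e2 = e3" "lie_bracket e1 e3 = 0" "lie_bracket e2 e3 = 0"
    and dual_basis:
      "dual_apply d1 e1 = 1" "dual_apply d1 e2 = 0" "dual_apply d1 e3 = 0"
      "dual_apply d2 e1 = 0" "dual_apply d2 e2 = 1" "dual_apply d2 e3 = 0"
      "dual_apply d3 e1 = 0" "dual_apply d3 e2 = 0" "dual_apply d3 e3 = 1"
  defines "E1 \<equiv> of_base e1" and "E2 \<equiv> of_base e2" and "E3 \<equiv> of_base e3"
    and "D1 \<equiv> of_dual d1" and "D2 \<equiv> of_dual d2" and "D3 \<equiv> of_dual d3"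
  shows
    "distinct [E1, E2, E3, D1, D2, D3]
     \<and> complex_vector.independent {E1, E2, E3, D1, D2, D3}
     \<and> complex_vector.span {E1, E2, E3, D1, D2, D3} = UNIV
     \<and> lie_bracket E1 E2 = E3 \<and> lie_bracket E1 D3 = - D2 \<and> lie_bracket E2 D3 = D1
     \<and> (\<forall>x \<in> {E1, E2, E3, D1, D2, D3}. \<forall>y \<in> {E1, E2, E3, D1, D2, D3}.
          (x, y) \<notin> {(E1, E2), (E2, E1), (E1, D3), (D3, E1), (E2, D3), (D3, E2)}
            \<longrightarrow> lie_bracket x y = 0)
     \<and> (\<forall>n21 n23.
          CYBE_solution ((n21 *\<^sub>C E1 + n23 *\<^sub>C E3) \<otimes> D2 - D2 \<otimes> (n21 *\<^sub>C E1 + n23 *\<^sub>C E3)))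
     \<and> (\<forall>n11 n12 n23. n11 \<noteq> 0 \<longrightarrow> n12 \<noteq> 0 \<longrightarrow>
          (let u = n11 *\<^sub>C E1 + n12 *\<^sub>C E2 - (n12 * n23 / n11) *\<^sub>C E3;
               v = (- (n11\<^sup>2 / n12)) *\<^sub>C E1 - n11 *\<^sub>C E2 + n23 *\<^sub>C E3
           in CYBE_solution (u \<otimes> D1 + v \<otimes> D2 - D1 \<otimes> u - D2 \<otimes> v)))
     \<and> (\<forall>n12 n13. n12 \<noteq> 0 \<longrightarrow>
          CYBE_solution ((n12 *\<^sub>C E2 + n13 *\<^sub>C E3) \<otimes> D1 - D1 \<otimes> (n12 *\<^sub>C E2 + n13 *\<^sub>C E3)))
     \<and> (\<forall>n13 n23.
          CYBE_solution ((n13 *\<^sub>C E3) \<otimes> D1 + (n23 *\<^sub>C E3) \<otimes> D2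
            - D1 \<otimes> (n13 *\<^sub>C E3) - D2 \<otimes> (n23 *\<^sub>C E3)))
     \<and> (\<forall>lam s n12 n13. s\<^sup>2 = 1 - 4 * lam \<longrightarrow> n12 \<noteq> 0 \<longrightarrow> lam \<noteq> 0 \<longrightarrow>
          (let k = (- 1 + s) / 2;
               w = (k * n12) *\<^sub>C E1 + n12 *\<^sub>C E2 + n13 *\<^sub>C E3
           in CYBE_solution (w \<otimes> D1 - (k *\<^sub>C w) \<otimes> D2 - D1 \<otimes> w + D2 \<otimes> (k *\<^sub>C w))))
     \<and> (\<forall>lam s n12 n13. s\<^sup>2 = 1 - 4 * lam \<longrightarrow> n12 \<noteq> 0 \<longrightarrow> lam \<noteq> 0 \<longrightarrow>
          (let k = (- 1 - s) / 2;
               w = (k * n12) *\<^sub>C E1 + n12 *\<^sub>C E2 + n13 *\<^sub>C E3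
           in CYBE_solution (w \<otimes> D1 - (k *\<^sub>C w) \<otimes> D2 - D1 \<otimes> w + D2 \<otimes> (k *\<^sub>C w))))"
proof -
  note E = E1_def E2_def E3_def D1_def D2_def D3_def
  note dual_basis [simp]
  note dualI = dual_eq_on_spanning[OF basis(3)]
  have skew: "lie_bracket e2 e1 = - e3" "lie_bracket e3 e1 = 0" "lie_bracket e3 e2 = 0"
    using lie_bracket_skew[of e2 e1] lie_bracket_skew[of e3 e1] lie_bracket_skew[of e3 e2]
    by (simp_all add: bracket)
  have minus: "dual_apply \<xi> (- x) = - dual_apply \<xi> x" for \<xi> :: "'g dual" and x
    using clinear_diff[OF clinear_dual_apply, of \<xi> 0 x] by simp
  \<comment> \<open>Every bracket of basis vectors is a multiple of \<open>e3\<close>, which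
    \<open>d1\<close> and \<open>d2\<close> annihilate; only \<open>d3\<close> detects it, with the
    sign of the coadjoint action.\<close>
  have coad: "coad e1 d1 = 0" "coad e2 d1 = 0" "coad e3 d1 = 0"
    "coad e1 d2 = 0" "coad e2 d2 = 0" "coad e3 d2 = 0"
    "coad e1 d3 = - d2" "coad e2 d3 = d1" "coad e3 d3 = 0"
    by (rule dualI; auto simp: bracket skew minus lie_bracket_self)+
  have base0: "of_base 0 = 0" and dual0: "of_dual 0 = 0"
    by (simp_all add: of_base_def of_dual_def zero_coad_semidirect_def)
  have base_minus: "of_base (- x) = - of_base x" for x :: 'g
    by (simp add: of_base_def uminus_coad_semidirect_def)
  note br = lie_bracket_of_base_of_dual bracket skew coad lie_bracket_self base0 dual0
    of_dual_uminus base_minus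

  \<comment> \<open>The basis of the semidirect product\<close>
  have neq: "e1 \<noteq> 0" "e2 \<noteq> 0" "e3 \<noteq> 0"
    using dual_basis by (auto simp del: dual_basis)
  have dneq: "d1 \<noteq> 0" "d2 \<noteq> 0" "d3 \<noteq> 0" "d1 \<noteq> d2" "d1 \<noteq> d3" "d2 \<noteq> d3"
    using dual_basis by (auto simp del: dual_basis)
  \<comment> \<open>The images of \<open>of_base\<close> and \<open>of_dual\<close> meet only in 0,
    so nonzero vectors from different halves differ.\<close>
  have distinct: "distinct [E1, E2, E3, D1, D2, D3]"
    using basis(1) neq dneq by (auto simp: E of_base_def of_dual_def)

  have independent: "complex_vector.independent {E1, E2, E3, D1, D2, D3}"
  proof (rule independent_if_separated)
    let ?P = "\<lambda>b f. clinear f \<and> f b \<noteq> 0 \<and> (\<forall>x \<in> {E1, E2, E3, D1, D2, D3} - {b}. f x = (0::complex))"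
    fix b assume "b \<in> {E1, E2, E3, D1, D2, D3}"
    \<comment> \<open>The functional dual to \<open>E1\<close>, \<open>E2\<close>, \<open>E3\<close>
      is the matching \<open>d1\<close>, \<open>d2\<close>, \<open>d3\<close> on the base part; the
      one dual to \<open>D1\<close>, \<open>D2\<close>, \<open>D3\<close> is evaluation of the dual
      part at \<open>e1\<close>, \<open>e2\<close>, \<open>e3\<close>.\<close>
    moreover have "?P E1 (\<lambda>s. dual_apply d1 (base_part s))"
      "?P E2 (\<lambda>s. dual_apply d2 (base_part s))" "?P E3 (\<lambda>s. dual_apply d3 (base_part s))"
      by (auto simp: clinear_dual_apply_base_part E of_base_def of_dual_def)
    moreover have "?P D1 (\<lambda>s. dual_apply (dual_part s) e1)"
      "?P D2 (\<lambda>s. dual_apply (dual_part s) e2)" "?P D3 (\<lambda>s. dual_apply (dual_part s) e3)"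
      by (auto simp: clinear_dual_apply_dual_part E of_base_def of_dual_def)
    ultimately show "\<exists>f. ?P b f" by blast
  qed

  have span: "complex_vector.span {E1, E2, E3, D1, D2, D3} = UNIV"
  proof (intro equalityI subset_UNIV subsetI)
    fix s :: "'g coad_semidirect"
    obtain x \<xi> where s: "s = Semi x \<xi>" by (cases s)
    \<comment> \<open>Both sides are linear in \<open>x\<close> and agree on the basis.\<close>
    have x: "x = dual_apply d1 x *\<^sub>C e1 + dual_apply d2 x *\<^sub>C e2 + dual_apply d3 x *\<^sub>C e3"
      by (rule clinear_eq_on_spanning[OF _ _ basis(3), of "\<lambda>x. x"
            "\<lambda>x. dual_apply d1 x *\<^sub>C e1 + dual_apply d2 x *\<^sub>C e2 + dual_apply d3 x *\<^sub>C e3"])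
        (auto intro!: clinearI simp: scaleC_add_left scaleC_add_right scaleC_scaleC
          scaleC_complex_def scaleC_one)
    have \<xi>: "\<xi> = dual_apply \<xi> e1 *\<^sub>C d1 + dual_apply \<xi> e2 *\<^sub>C d2 + dual_apply \<xi> e3 *\<^sub>C d3"
      by (rule dualI) auto
    have "s = of_base x + of_dual \<xi>"
      by (simp add: s of_base_def of_dual_def plus_coad_semidirect_def)
    \<comment> \<open>Both expansions are inserted exactly once, since \<open>x\<close> and
      \<open>\<xi>\<close> recur in their own coordinates.\<close>
    also note arg_cong2[OF x \<xi>, of "\<lambda>x \<xi>. of_base x + of_dual \<xi>"]
    also have "of_base (dual_apply d1 x *\<^sub>C e1 + dual_apply d2 x *\<^sub>C e2 + dual_apply d3 x *\<^sub>C e3)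
        + of_dual (dual_apply \<xi> e1 *\<^sub>C d1 + dual_apply \<xi> e2 *\<^sub>C d2 + dual_apply \<xi> e3 *\<^sub>C d3) = dual_apply d1 x *\<^sub>C E1 + dual_apply d2 x *\<^sub>C E2 + dual_apply d3 x *\<^sub>C E3
        + (dual_apply \<xi> e1 *\<^sub>C D1 + dual_apply \<xi> e2 *\<^sub>C D2 + dual_apply \<xi> e3 *\<^sub>C D3)"
      by (simp add: E clinear_add[OF clinear_of_base]
          clinear_scaleC[OF clinear_of_base] clinear_add[OF clinear_of_dual]
          clinear_scaleC[OF clinear_of_dual])
    also have "\<dots> \<in> complex_vector.span {E1, E2, E3, D1, D2, D3}"
      by (intro complex_vector.span_add complex_vector.span_scale complex_vector.span_base) auto
    finally show "s \<in> complex_vector.span {E1, E2, E3, D1, D2, D3}" .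
  qed

  \<comment> \<open>The bracket table\<close>
  have nonzero: "lie_bracket E1 E2 = E3" "lie_bracket E1 D3 = - D2" "lie_bracket E2 D3 = D1"
    by (simp_all add: E br)

  have zero_brackets: "\<forall>x \<in> {E1, E2, E3, D1, D2, D3}. \<forall>y \<in> {E1, E2, E3, D1, D2, D3}.
          (x, y) \<notin> {(E1, E2), (E2, E1), (E1, D3), (D3, E1), (E2, D3), (D3, E2)}
            \<longrightarrow> lie_bracket x y = 0"
    by (simp add: E br)

  \<comment> \<open>The six solutions\<close>
  have sol: "CYBE_solution (u \<otimes> D1 + v \<otimes> D2 - D1 \<otimes> u - D2 \<otimes> v)"
    if uv: "u = a1 *\<^sub>C E1 + a2 *\<^sub>C E2 + a3 *\<^sub>C E3" "v = b1 *\<^sub>C E1 + b2 *\<^sub>C E2 + b3 *\<^sub>C E3"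
      and det: "a1 * b2 = a2 * b1" for u v a1 a2 a3 b1 b2 b3
  proof (rule CYBE_solution_skew)
    \<comment> \<open>All brackets with \<open>D1\<close> and \<open>D2\<close> vanish because the
      coadjoint action kills \<open>d1\<close> and \<open>d2\<close>; what remains is the bracket of
      \<open>u\<close> and \<open>v\<close>.\<close>
    have central: "lie_bracket u D1 = 0" "lie_bracket u D2 = 0" "lie_bracket v D1 = 0"
      "lie_bracket v D2 = 0" "lie_bracket D1 D2 = 0"
      by (simp_all add: uv E br lie_bracket_add_left lie_bracket_scaleC_left)
    moreover have uv0: "lie_bracket u v = 0"
    proof -
      \<comment> \<open>Since \<open>E3\<close> commutes with \<open>E1\<close> and
        \<open>E2\<close>, only the 2 by 2 minor of the \<open>E1\<close>, \<open>E2\<close>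
        coordinates survives; \<open>det\<close> says that it is 0.\<close>
      have "lie_bracket u v = (a1 * b2 - a2 * b1) *\<^sub>C E3"
        by (simp add: uv E br lie_bracket_add_left lie_bracket_scaleC_left lie_bracket_add_right
            lie_bracket_scaleC_right scaleC_scaleC complex_vector.scale_left_diff_distrib
            mult.commute scaleC_add_right)
      then show ?thesis by (simp add: det)
    qed
    ultimately show "lie_bracket x y = 0" if "x \<in> {u, v, D1, D2}" "y \<in> {u, v, D1, D2}" for x y
      using that uv0 lie_bracket_skew[of D1 u] lie_bracket_skew[of D1 v] lie_bracket_skew[of D2 u]
        lie_bracket_skew[of D2 v] lie_bracket_skew[of v u] lie_bracket_skew[of D2 D1]
      by (auto simp: lie_bracket_self)
  qed
  have zero: "0 \<otimes> x = 0" "x \<otimes> 0 = 0" for x :: "'g coad_semidirect"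
    using tensor_linear(3)[of 0 0 x] tensor_linear(4)[of x 0 0] by simp_all
  have neg: "(- x) \<otimes> y = - (x \<otimes> y)" "y \<otimes> (- x) = - (y \<otimes> x)" for x y :: "'g coad_semidirect"
    using tensor_linear(3)[of "-1" x y] tensor_linear(4)[of y "-1" x] by simp_all

  have r1: "CYBE_solution ((n21 *\<^sub>C E1 + n23 *\<^sub>C E3) \<otimes> D2 - D2 \<otimes> (n21 *\<^sub>C E1 + n23 *\<^sub>C E3))"
    for n21 n23
    \<comment> \<open>Here \<open>u = 0\<close>, and the two tensors containing it drop out.\<close>
    using sol[of 0 0 0 0 "n21 *\<^sub>C E1 + n23 *\<^sub>C E3" n21 0 n23] by (simp add: zero)

  have r2: "let u = n11 *\<^sub>C E1 + n12 *\<^sub>C E2 - (n12 * n23 / n11) *\<^sub>C E3;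
               v = (- (n11\<^sup>2 / n12)) *\<^sub>C E1 - n11 *\<^sub>C E2 + n23 *\<^sub>C E3
           in CYBE_solution (u \<otimes> D1 + v \<otimes> D2 - D1 \<otimes> u - D2 \<otimes> v)"
    if "n11 \<noteq> 0" "n12 \<noteq> 0" for n11 n12 n23
    unfolding Let_def
    \<comment> \<open>Both products in \<open>det\<close> equal \<open>- n11\<^sup>2\<close>, the
      second after cancelling \<open>n12\<close>.\<close>
    by (rule sol[of _ n11 n12 "- (n12 * n23 / n11)" _ "- (n11\<^sup>2 / n12)" "- n11" n23])
      (use that in \<open>simp_all add: power2_eq_square\<close>)

  have r3: "CYBE_solution ((n12 *\<^sub>C E2 + n13 *\<^sub>C E3) \<otimes> D1 - D1 \<otimes> (n12 *\<^sub>C E2 + n13 *\<^sub>C E3))"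
    for n12 n13
    using sol[of "n12 *\<^sub>C E2 + n13 *\<^sub>C E3" 0 n12 n13 0 0 0 0] by (simp add: zero)

  have r4: "CYBE_solution ((n13 *\<^sub>C E3) \<otimes> D1 + (n23 *\<^sub>C E3) \<otimes> D2
            - D1 \<otimes> (n13 *\<^sub>C E3) - D2 \<otimes> (n23 *\<^sub>C E3))" for n13 n23
    by (rule sol[of _ 0 0 n13 _ 0 0 n23]) simp_all

  \<comment> \<open>The last two families are treated together, as they differ only in the value of
    \<open>k\<close>. With \<open>u = w\<close> and \<open>v = - (k *\<^sub>C w)\<close> the two
    vectors are proportional, so the minor vanishes.\<close>
  have r56: "let w = (k * n12) *\<^sub>C E1 + n12 *\<^sub>C E2 + n13 *\<^sub>C E3
           in CYBE_solution (w \<otimes> D1 - (k *\<^sub>C w) \<otimes> D2 - D1 \<otimes> w + D2 \<otimes> (k *\<^sub>C w))"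
    for k n12 n13
  proof -
    define w where "w = (k * n12) *\<^sub>C E1 + n12 *\<^sub>C E2 + n13 *\<^sub>C E3"
    \<comment> \<open>The sign is kept inside \<open>v\<close> to match \<open>sol\<close>;
      \<open>neg\<close> then moves it out of the tensors and yields the stated form.\<close>
    have "CYBE_solution (w \<otimes> D1 + (- (k *\<^sub>C w)) \<otimes> D2 - D1 \<otimes> w - D2 \<otimes> (- (k *\<^sub>C w)))"
      by (rule sol[of _ "k * n12" n12 n13 _ "- (k * k * n12)" "- (k * n12)" "- (k * n13)"])
        (simp_all add: w_def scaleC_add_right scaleC_scaleC mult.assoc)
    then show ?thesis by (simp add: neg w_def)
  qed

  show ?thesis
    by (intro conjI allI impI; (rule distinct independent span nonzero zero_brackets r1 r2 r3 r4
          | subst Let_def, rule r56)?)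
qed

end
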